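(* Let $G=(V,E)$ be a locally finite, connected weighted graph with uniformly positive measure and symmetric, uniformly bounded weights (precise conditions in the context). Let $W^{2,2}(V)$ be the space of all functions $u:V\to\mathbb R$ with $\|u\|_{W^{2,2}(V)}^2=\int_V(|\Delta u|^2+|\nabla u|^2+u^2)d\mu<+\infty$. Then $W^{2,2}(V)$ is the completion of $C_c(V)$ under the norm $\|\cdot\|_{W^{2,2}(V)}$.
   Context: $G=(V,E)$ is a graph with vertex set $V$ and edge set $E$; $y\sim x$ means $xy\in E$. It is assumed that: each vertex has finitely many neighbours (locally finite); any two vertices can be joined by finitely many edges (connected); there is a measure $\mu:V\to(0,\infty)$ and a constant $\mu_{\min}>0$ with $\mu(x)\ge\mu_{\min}$ for all $x\in V$; each edge $xy$ has a positive weight $\omega_{xy}=\omega_{yx}$, and there is a constant $C$ with $\sum_{y\sim x}\omega_{xy}<C$ for all $x\in V$. For $u:V\to\mathbb R$: $\Delta u(x)=\frac1{\mu(x)}\sum_{y\sim x}\omega_{xy}(u(y)-u(x))$, $|\nabla u|^2(x)=\frac1{2\mu(x)}\sum_{y\sim x}\omega_{xy}(u(y)-u(x))^2$ and $\int_V u\,d\mu=\sum_{x\in V}\mu(x)u(x)$. $C_c(V)$ is the set of functions $V\to\mathbb R$ with finite support. *)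

theory Defs
  imports "HOL-Analysis.Analysis" "HOL-Library.Function_Algebras"
begin

text \<open>The vertex set is the type \<open>'v\<close>. The edge set is a symmetric relation, so that \<open>E `` {x}\<close> is
  the set of neighbours of \<open>x\<close>. Loops are not excluded; a loop contributes only to the bound on the
  sum of the weights, since it cancels in the differences \<open>u y - u x\<close>. The weight function
  is constrained on edges only.\<close>

locale weighted_graph =
  fixes E :: "('v \<times> 'v) set"
    and \<mu> :: "'v \<Rightarrow> real"
    and \<omega> :: "'v \<Rightarrow> 'v \<Rightarrow> real"
  assumes edges_sym: "sym E"
    and locally_finite: "\<And>x. finite (E `` {x})"
    and connected: "\<And>x y. (x, y) \<in> E\<^sup>*"
    and measure_bounded_below: "\<exists>\<mu>_min>0. \<forall>x. \<mu> x \<ge> \<mu>_min"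
    and weight_pos: "\<And>x y. (x, y) \<in> E \<Longrightarrow> \<omega> x y > 0"
    and weight_sym: "\<And>x y. (x, y) \<in> E \<Longrightarrow> \<omega> x y = \<omega> y x"
    and weights_bounded: "\<exists>C. \<forall>x. (\<Sum>y\<in>E `` {x}. \<omega> x y) < C"

definition laplacian ::
    "('v \<times> 'v) set \<Rightarrow> ('v \<Rightarrow> real) \<Rightarrow> ('v \<Rightarrow> 'v \<Rightarrow> real) \<Rightarrow> ('v \<Rightarrow> real) \<Rightarrow> 'v \<Rightarrow> real"
  where "laplacian E \<mu> \<omega> u x = 1 / \<mu> x * (\<Sum>y\<in>E `` {x}. \<omega> x y * (u y - u x))"

definition grad_sq ::
    "('v \<times> 'v) set \<Rightarrow> ('v \<Rightarrow> real) \<Rightarrow> ('v \<Rightarrow> 'v \<Rightarrow> real) \<Rightarrow> ('v \<Rightarrow> real) \<Rightarrow> 'v \<Rightarrow> real"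
  where "grad_sq E \<mu> \<omega> u x = 1 / (2 * \<mu> x) * (\<Sum>y\<in>E `` {x}. \<omega> x y * (u y - u x)\<^sup>2)"

text \<open>The sum defining the integral is unordered. For a nonnegative integrand, \<open>integrable_V\<close> says
  that the integral is finite; without it \<open>integral_V\<close> has the default value \<open>0\<close>.\<close>

definition integrable_V :: "('v \<Rightarrow> real) \<Rightarrow> ('v \<Rightarrow> real) \<Rightarrow> bool"
  where "integrable_V \<mu> f \<longleftrightarrow> (\<lambda>x. \<mu> x * f x) summable_on UNIV"

definition integral_V :: "('v \<Rightarrow> real) \<Rightarrow> ('v \<Rightarrow> real) \<Rightarrow> real"
  where "integral_V \<mu> f = (\<Sum>\<^sub>\<infinity>x. \<mu> x * f x)"

definition W22_density ::
    "('v \<times> 'v) set \<Rightarrow> ('v \<Rightarrow> real) \<Rightarrow> ('v \<Rightarrow> 'v \<Rightarrow> real) \<Rightarrow> ('v \<Rightarrow> real) \<Rightarrow> 'v \<Rightarrow> real"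
  where "W22_density E \<mu> \<omega> u x = \<bar>laplacian E \<mu> \<omega> u x\<bar>\<^sup>2 + grad_sq E \<mu> \<omega> u x + (u x)\<^sup>2"

definition W22 ::
    "('v \<times> 'v) set \<Rightarrow> ('v \<Rightarrow> real) \<Rightarrow> ('v \<Rightarrow> 'v \<Rightarrow> real) \<Rightarrow> ('v \<Rightarrow> real) set"
  where "W22 E \<mu> \<omega> = {u. integrable_V \<mu> (W22_density E \<mu> \<omega> u)}"

definition W22_norm ::
    "('v \<times> 'v) set \<Rightarrow> ('v \<Rightarrow> real) \<Rightarrow> ('v \<Rightarrow> 'v \<Rightarrow> real) \<Rightarrow> ('v \<Rightarrow> real) \<Rightarrow> real"
  where "W22_norm E \<mu> \<omega> u = sqrt (integral_V \<mu> (W22_density E \<mu> \<omega> u))"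

definition C_c :: "('v \<Rightarrow> real) set"
  where "C_c = {u. finite {x. u x \<noteq> 0}}"

interpretation fun_space: vector_space "\<lambda>c (u :: 'v \<Rightarrow> real) x. c * u x"
  by unfold_locales (auto simp: fun_eq_iff algebra_simps)

definition norm_on :: "('v \<Rightarrow> real) set \<Rightarrow> (('v \<Rightarrow> real) \<Rightarrow> real) \<Rightarrow> bool"
  where "norm_on W N \<longleftrightarrow>
    (\<forall>u\<in>W. 0 \<le> N u \<and> (N u = 0 \<longleftrightarrow> u = 0)) \<and>
    (\<forall>c. \<forall>u\<in>W. N (\<lambda>x. c * u x) = \<bar>c\<bar> * N u) \<and>
    (\<forall>u\<in>W. \<forall>v\<in>W. N (u + v) \<le> N u + N v)"

text \<open>\<open>W\<close> is a completion of the normed space \<open>(D, N)\<close>, realised as a space of functions containing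
  \<open>D\<close>: a Banach space under \<open>N\<close> in which the linear subspace \<open>D\<close> is dense.\<close>

definition is_completion_of ::
    "('v \<Rightarrow> real) set \<Rightarrow> ('v \<Rightarrow> real) set \<Rightarrow> (('v \<Rightarrow> real) \<Rightarrow> real) \<Rightarrow> bool"
  where "is_completion_of W D N \<longleftrightarrow>
    fun_space.subspace W \<and> norm_on W N \<and>
    Metric_space W (\<lambda>u v. N (u - v)) \<and> Metric_space.mcomplete W (\<lambda>u v. N (u - v)) \<and>
    fun_space.subspace D \<and> D \<subseteq> W \<and>
    Metric_space.mtopology W (\<lambda>u v. N (u - v)) closure_of D = W"

end

theory Submission
  imports Defs
begin

text \<open>The square of the \<open>W\<^sup>2\<^sup>,\<^sup>2\<close> norm is an unordered sum of squares of linear functionals, each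
  depending on finitely many values. Hence the norm is the supremum of its restrictions to finite
  vertex sets, which yields the triangle inequality, and completeness follows by taking pointwise
  limits in the restrictions. For density, bounded weights and the lower bound of the measure give
  the energy estimate \<open>\<parallel>w\<parallel>\<^sup>2 \<le> K \<integral> w\<^sup>2 d\<mu>\<close>; apply it to \<open>w = u 1\<^bsub>V - A\<^esub>\<close> for a large finite
  set \<open>A\<close>.\<close>

section \<open>Linear structure of the finitely supported functions\<close>

lemma subspace_C_c: "fun_space.subspace C_c"
  unfolding fun_space.subspace_def C_c_def
proof (intro conjI ballI allI CollectI)
  fix u v :: "'a \<Rightarrow> real" and c :: real
  assume "u \<in> {u. finite {x. u x \<noteq> 0}}" "v \<in> {u. finite {x. u x \<noteq> 0}}"
  then have u: "finite {x. u x \<noteq> 0}" and v: "finite {x. v x \<noteq> 0}"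
    by auto
  show "finite {x. (u + v) x \<noteq> 0}"
    by (rule finite_subset[OF _ finite_UnI[OF u v]]) auto
next
  fix u :: "'a \<Rightarrow> real" and c :: real
  assume u: "u \<in> {u. finite {x. u x \<noteq> 0}}"
  show "finite {x. c * u x \<noteq> 0}"
    by (rule finite_subset[of _ "{x. u x \<noteq> 0}"]) (use u in auto)
qed auto

context weighted_graph
begin

section \<open>Euclidean norms over finite vertex sets\<close>

lemma measure_pos: "\<mu> x > 0"
  using measure_bounded_below by (metis less_le_trans)

lemma weight_nonneg: "y \<in> E `` {x} \<Longrightarrow> 0 \<le> \<omega> x y"
  using weight_pos[of x y] by simp

lemma grad_sq_nonneg: "0 \<le> grad_sq E \<mu> \<omega> u x"
  unfolding grad_sq_def using measure_pos[of x]
  by (intro mult_nonneg_nonneg sum_nonneg weight_nonneg) auto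

lemma W22_density_nonneg: "0 \<le> W22_density E \<mu> \<omega> u x"
  unfolding W22_density_def using grad_sq_nonneg[of u x] by simp

text \<open>The factors are chosen so that the squares at \<open>x\<close> add up to the integrand
  of the squared norm, measure included. In the gradient terms the measure cancels and half the
  weight remains. The nested options add two indices to those of the neighbours.\<close>

definition W22_component :: "('v \<Rightarrow> real) \<Rightarrow> 'v \<Rightarrow> 'v option option \<Rightarrow> real" where
  "W22_component u x i = (case i of
      None \<Rightarrow> sqrt (\<mu> x) * laplacian E \<mu> \<omega> u x
    | Some None \<Rightarrow> sqrt (\<mu> x) * u x
    | Some (Some y) \<Rightarrow> sqrt (\<omega> x y / 2) * (u y - u x))"

definition W22_components :: "'v \<Rightarrow> 'v option option set" where
  "W22_components x = insert None (insert (Some None) ((Some \<circ> Some) ` (E `` {x})))"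

lemma finite_W22_components: "finite (W22_components x)"
  by (simp add: W22_components_def locally_finite)

lemma sum_W22_component:
  "(\<Sum>i\<in>W22_components x. (W22_component u x i)\<^sup>2) = \<mu> x * W22_density E \<mu> \<omega> u x"
proof -
  have "(\<Sum>i\<in>W22_components x. (W22_component u x i)\<^sup>2)
      = \<mu> x * (laplacian E \<mu> \<omega> u x)\<^sup>2 + (\<mu> x * (u x)\<^sup>2
        + (\<Sum>y\<in>E `` {x}. (sqrt (\<omega> x y / 2) * (u y - u x))\<^sup>2))"
    unfolding W22_components_def using measure_pos[of x]
    by (subst sum.insert; simp add: locally_finite image_iff sum.reindex inj_on_def W22_component_def
        power_mult_distrib less_imp_le)
  also have "(\<Sum>y\<in>E `` {x}. (sqrt (\<omega> x y / 2) * (u y - u x))\<^sup>2)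
      = (\<Sum>y\<in>E `` {x}. \<omega> x y * (u y - u x)\<^sup>2 / 2)"
    by (intro sum.cong) (use weight_nonneg in \<open>auto simp: power_mult_distrib\<close>)
  also have "\<dots> = \<mu> x * grad_sq E \<mu> \<omega> u x"
    unfolding grad_sq_def using measure_pos[of x] by (simp flip: sum_divide_distrib)
  finally show ?thesis
    by (simp add: W22_density_def algebra_simps)
qed

text \<open>The form as an \<open>L2_set\<close> of linear components makes Minkowski's inequality
  available; \<open>partial_norm_eq\<close> returns to the density when \<open>F\<close> is finite.
  For infinite \<open>F\<close> the value is the default 0.\<close>

definition partial_norm :: "'v set \<Rightarrow> ('v \<Rightarrow> real) \<Rightarrow> real" where
  "partial_norm F u = L2_set (\<lambda>(x, i). W22_component u x i) (Sigma F W22_components)"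

lemma partial_norm_eq:
  assumes "finite F"
  shows "partial_norm F u = sqrt (\<Sum>x\<in>F. \<mu> x * W22_density E \<mu> \<omega> u x)"
  unfolding partial_norm_def L2_set_def
  by (subst sum_W22_component[symmetric], subst sum.Sigma)
    (auto simp: assms finite_W22_components case_prod_unfold)

lemma laplacian_add: "laplacian E \<mu> \<omega> (u + v) x = laplacian E \<mu> \<omega> u x + laplacian E \<mu> \<omega> v x"
  unfolding laplacian_def
  by (simp only: sum.distrib[symmetric] distrib_left[symmetric])
    (intro arg_cong2[where f = "(*)"] sum.cong; simp add: algebra_simps)

lemma W22_component_add: "W22_component (u + v) x i = W22_component u x i + W22_component v x i"
  unfolding W22_component_def by (auto simp: laplacian_add algebra_simps split: option.split)

lemma partial_norm_triangle: "partial_norm F (u + v) \<le> partial_norm F u + partial_norm F v"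
  unfolding partial_norm_def
  by (rule order_trans[OF _ L2_set_triangle_ineq]) (simp add: W22_component_add case_prod_unfold)

text \<open>Each component is a continuous function of finitely many values, so pointwise
  convergence passes through. No uniformity in \<open>F\<close> is claimed.\<close>

lemma tendsto_partial_norm:
  assumes "\<And>x. (\<lambda>n. u n x) \<longlonglongrightarrow> l x"
  shows "(\<lambda>n. partial_norm F (u n)) \<longlonglongrightarrow> partial_norm F l"
proof -
  have "(\<lambda>n. laplacian E \<mu> \<omega> (u n) x) \<longlonglongrightarrow> laplacian E \<mu> \<omega> l x" for x
    unfolding laplacian_def by (intro tendsto_mult tendsto_const tendsto_sum tendsto_diff assms)
  then have "(\<lambda>n. W22_component (u n) x i) \<longlonglongrightarrow> W22_component l x i" for x i
    unfolding W22_component_def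
    by (auto split: option.split intro!: tendsto_mult_left tendsto_diff assms)
  then show ?thesis
    unfolding partial_norm_def L2_set_def case_prod_unfold by (intro tendsto_intros)
qed

section \<open>The norm as a supremum of partial norms, and the normed space axioms\<close>

lemma W22_norm_nonneg: "0 \<le> W22_norm E \<mu> \<omega> u"
  unfolding W22_norm_def integral_V_def
  using measure_pos W22_density_nonneg by (auto intro!: infsum_nonneg simp: less_imp_le)

lemma partial_norm_le_W22_norm:
  assumes "u \<in> W22 E \<mu> \<omega>" "finite F"
  shows "partial_norm F u \<le> W22_norm E \<mu> \<omega> u"
  using assms measure_pos W22_density_nonneg
  by (auto simp: partial_norm_eq W22_norm_def integral_V_def W22_def integrable_V_def less_imp_le
      intro!: finite_sum_le_infsum)

text \<open>Converse to \<open>partial_norm_le_W22_norm\<close>: for a nonnegative integrand,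
  bounded finite sums give summability together with the bound. Sums, limits and truncations are all
  handled through this rule.\<close>

lemma W22_norm_leI:
  assumes "\<And>F. finite F \<Longrightarrow> partial_norm F u \<le> B"
  shows "u \<in> W22 E \<mu> \<omega>" and "W22_norm E \<mu> \<omega> u \<le> B"
proof -
  \<comment> \<open>The empty set supplies the sign of \<open>B\<close>, which the final passage
    from \<open>B\<^sup>2\<close> to \<open>B\<close> requires.\<close>
  have B: "B \<ge> 0"
    using assms[of "{}"] by (simp add: partial_norm_def)
  have le: "(\<Sum>x\<in>F. \<mu> x * W22_density E \<mu> \<omega> u x) \<le> B\<^sup>2" if "finite F" for F
    using assms[OF that] that by (simp add: partial_norm_eq sqrt_le_D)
  have s: "(\<lambda>x. \<mu> x * W22_density E \<mu> \<omega> u x) summable_on UNIV"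
    using le measure_pos W22_density_nonneg
    by (intro nonneg_bdd_above_summable_on bdd_aboveI2[where M = "B\<^sup>2"]) (auto simp: less_imp_le)
  then show "u \<in> W22 E \<mu> \<omega>"
    by (simp add: W22_def integrable_V_def)
  show "W22_norm E \<mu> \<omega> u \<le> B"
    unfolding W22_norm_def integral_V_def
    by (rule real_le_lsqrt[OF B]) (use infsum_le_finite_sums[OF s] le in auto)
qed

lemma W22_add:
  assumes "u \<in> W22 E \<mu> \<omega>" "v \<in> W22 E \<mu> \<omega>"
  shows "u + v \<in> W22 E \<mu> \<omega>"
    and "W22_norm E \<mu> \<omega> (u + v) \<le> W22_norm E \<mu> \<omega> u + W22_norm E \<mu> \<omega> v"
proof -
  have "partial_norm F (u + v) \<le> W22_norm E \<mu> \<omega> u + W22_norm E \<mu> \<omega> v" if "finite F" for F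
    using partial_norm_triangle[of F u v] partial_norm_le_W22_norm[OF assms(1) that]
      partial_norm_le_W22_norm[OF assms(2) that] by linarith
  then show "u + v \<in> W22 E \<mu> \<omega>"
    and "W22_norm E \<mu> \<omega> (u + v) \<le> W22_norm E \<mu> \<omega> u + W22_norm E \<mu> \<omega> v"
    by (auto intro: W22_norm_leI)
qed

lemma W22_density_scale: "W22_density E \<mu> \<omega> (\<lambda>x. c * u x) x = c\<^sup>2 * W22_density E \<mu> \<omega> u x"
proof -
  have "laplacian E \<mu> \<omega> (\<lambda>x. c * u x) x = c * laplacian E \<mu> \<omega> u x"
    unfolding laplacian_def by (simp add: sum_distrib_left algebra_simps)
  moreover have "grad_sq E \<mu> \<omega> (\<lambda>x. c * u x) x = c\<^sup>2 * grad_sq E \<mu> \<omega> u x"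
    unfolding grad_sq_def by (simp add: sum_distrib_left power_mult_distrib mult.left_commute
        flip: right_diff_distrib)
  ultimately show ?thesis
    by (simp add: W22_density_def power_mult_distrib distrib_left)
qed

lemma W22_scale: "u \<in> W22 E \<mu> \<omega> \<Longrightarrow> (\<lambda>x. c * u x) \<in> W22 E \<mu> \<omega>"
  unfolding W22_def integrable_V_def
  by (auto simp: W22_density_scale mult.left_commute[of _ "c\<^sup>2"] intro!: summable_on_cmult_right)

text \<open>This covers \<open>u\<close> outside the space as well: there the integral has the
  default value 0 and both sides vanish. \<open>Metric_space\<close> asks for symmetry of the
  distance at all pairs of functions, so this generality is used.\<close>

lemma W22_norm_scale: "W22_norm E \<mu> \<omega> (\<lambda>x. c * u x) = \<bar>c\<bar> * W22_norm E \<mu> \<omega> u"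
  unfolding W22_norm_def integral_V_def
  by (simp add: W22_density_scale mult.left_commute[of _ "c\<^sup>2"] infsum_cmult_right' real_sqrt_mult)

lemma W22_minus: "u \<in> W22 E \<mu> \<omega> \<Longrightarrow> - u \<in> W22 E \<mu> \<omega>"
  using W22_scale[of u "-1"] by (simp add: fun_Compl_def)

lemma W22_norm_minus: "W22_norm E \<mu> \<omega> (- u) = W22_norm E \<mu> \<omega> u"
  using W22_norm_scale[of "-1" u] by (simp add: fun_Compl_def)

lemma W22_diff: "u \<in> W22 E \<mu> \<omega> \<Longrightarrow> v \<in> W22 E \<mu> \<omega> \<Longrightarrow> u - v \<in> W22 E \<mu> \<omega>"
  using W22_add(1)[of u "- v"] W22_minus[of v] by simp

lemma W22_zero: "0 \<in> W22 E \<mu> \<omega>" "W22_norm E \<mu> \<omega> 0 = 0"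
proof -
  have "partial_norm F 0 \<le> 0" for F
    unfolding partial_norm_def
    by (subst L2_set_0') (auto simp: W22_component_def laplacian_def split: option.split)
  then show "0 \<in> W22 E \<mu> \<omega>" "W22_norm E \<mu> \<omega> 0 = 0"
    using W22_norm_leI[of 0 0] W22_norm_nonneg[of 0] by auto
qed

text \<open>The weighted value at \<open>x\<close> is one of the components over \<open>{x}\<close>,
  so the norm controls every point evaluation. This gives definiteness, and pointwise limits of
  Cauchy sequences.\<close>

lemma value_le_W22_norm:
  assumes "u \<in> W22 E \<mu> \<omega>"
  shows "sqrt (\<mu> x) * \<bar>u x\<bar> \<le> W22_norm E \<mu> \<omega> u"
proof -
  have "(u x)\<^sup>2 \<le> W22_density E \<mu> \<omega> u x"
    unfolding W22_density_def using grad_sq_nonneg[of u x] by simp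
  then have "sqrt (\<mu> x * (u x)\<^sup>2) \<le> partial_norm {x} u"
    using measure_pos[of x] by (simp add: partial_norm_eq)
  also have "\<dots> \<le> W22_norm E \<mu> \<omega> u"
    using assms by (simp add: partial_norm_le_W22_norm)
  finally show ?thesis
    by (simp add: real_sqrt_mult)
qed

lemma W22_norm_eq_0_iff:
  assumes "u \<in> W22 E \<mu> \<omega>"
  shows "W22_norm E \<mu> \<omega> u = 0 \<longleftrightarrow> u = 0"
proof
  assume "W22_norm E \<mu> \<omega> u = 0"
  then have "sqrt (\<mu> x) * \<bar>u x\<bar> \<le> 0" for x
    using value_le_W22_norm[OF assms, of x] by simp
  then have "u x = 0" for x
    using measure_pos[of x] by (force simp: mult_le_0_iff not_le[symmetric])
  then show "u = 0"
    by (simp add: fun_eq_iff)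
qed (simp add: W22_zero)

lemma norm_on_W22: "norm_on (W22 E \<mu> \<omega>) (W22_norm E \<mu> \<omega>)"
  unfolding norm_on_def by (simp add: W22_norm_nonneg W22_norm_eq_0_iff W22_norm_scale W22_add)

lemma subspace_W22: "fun_space.subspace (W22 E \<mu> \<omega>)"
  unfolding fun_space.subspace_def by (simp add: W22_zero W22_add W22_scale)

section \<open>The metric and its completeness\<close>

lemma Metric_space_W22: "Metric_space (W22 E \<mu> \<omega>) (\<lambda>u v. W22_norm E \<mu> \<omega> (u - v))"
proof
  show "W22_norm E \<mu> \<omega> (u - v) = W22_norm E \<mu> \<omega> (v - u)" for u v
    using W22_norm_minus[of "u - v"] by simp
  show "W22_norm E \<mu> \<omega> (u - w) \<le> W22_norm E \<mu> \<omega> (u - v) + W22_norm E \<mu> \<omega> (v - w)"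
    if "u \<in> W22 E \<mu> \<omega>" "v \<in> W22 E \<mu> \<omega>" "w \<in> W22 E \<mu> \<omega>" for u v w
    using W22_add(2)[of "u - v" "v - w"] that by (simp add: W22_diff)
  show "W22_norm E \<mu> \<omega> (u - v) = 0 \<longleftrightarrow> u = v"
    if "u \<in> W22 E \<mu> \<omega>" "v \<in> W22 E \<mu> \<omega>" for u v
    using W22_norm_eq_0_iff[OF W22_diff[OF that]] by simp
qed (rule W22_norm_nonneg)

sublocale W22: Metric_space "W22 E \<mu> \<omega>" "\<lambda>u v. W22_norm E \<mu> \<omega> (u - v)"
  by (rule Metric_space_W22)

lemma mcomplete_W22: "W22.mcomplete"
  unfolding W22.mcomplete_def
proof (intro allI impI)
  fix u assume C: "W22.MCauchy u"
  then have u: "u n \<in> W22 E \<mu> \<omega>" for n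
    by (auto simp: W22.MCauchy_def)
  have small: "\<exists>N. \<forall>n\<ge>N. \<forall>m\<ge>N. W22_norm E \<mu> \<omega> (u n - u m) < \<epsilon>" if "\<epsilon> > 0" for \<epsilon>
    using C that unfolding W22.MCauchy_def by meson
  have "Cauchy (\<lambda>n. u n x)" for x
  proof (rule metric_CauchyI)
    fix \<epsilon> :: real assume "\<epsilon> > 0"
    \<comment> \<open>The threshold cancels the factor in \<open>value_le_W22_norm\<close>;
      \<open>N\<close> may depend on \<open>x\<close>.\<close>
    then obtain N where N: "\<And>n m. n \<ge> N \<Longrightarrow> m \<ge> N \<Longrightarrow> W22_norm E \<mu> \<omega> (u n - u m) < sqrt (\<mu> x) * \<epsilon>"
      using small[of "sqrt (\<mu> x) * \<epsilon>"] measure_pos[of x] by auto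
    have "dist (u n x) (u m x) < \<epsilon>" if "n \<ge> N" "m \<ge> N" for n m
    proof -
      have "sqrt (\<mu> x) * \<bar>u n x - u m x\<bar> < sqrt (\<mu> x) * \<epsilon>"
        using value_le_W22_norm[OF W22_diff[OF u u], of x n m] N[OF that] by simp
      then show ?thesis
        using measure_pos[of x] by (simp add: dist_real_def)
    qed
    then show "\<exists>N. \<forall>m\<ge>N. \<forall>n\<ge>N. dist (u m x) (u n x) < \<epsilon>"
      by blast
  qed
  then have "\<exists>l. (\<lambda>n. u n x) \<longlonglongrightarrow> l" for x
    by (simp add: Cauchy_convergent_iff convergent_def)
  then obtain l where l: "\<And>x. (\<lambda>n. u n x) \<longlonglongrightarrow> l x"
    by metis
  \<comment> \<open>Membership of the difference is part of the claim, because \<open>l\<close> is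
    so far only a pointwise limit; it is recovered below as \<open>u n - (u n - l)\<close>.\<close>
  have approx: "\<exists>N. \<forall>n\<ge>N. u n - l \<in> W22 E \<mu> \<omega> \<and> W22_norm E \<mu> \<omega> (u n - l) \<le> \<epsilon>" if "\<epsilon> > 0" for \<epsilon>
  proof -
    obtain N where N: "\<And>n m. n \<ge> N \<Longrightarrow> m \<ge> N \<Longrightarrow> W22_norm E \<mu> \<omega> (u n - u m) < \<epsilon>"
      using small[OF \<open>\<epsilon> > 0\<close>] by blast
    \<comment> \<open>With \<open>n\<close> and \<open>F\<close> fixed, \<open>m\<close> tends to
      infinity in the Cauchy bound. As \<open>N\<close> does not depend on \<open>F\<close>, the
      supremum over \<open>F\<close> can be taken afterwards.\<close>
    have "partial_norm F (u n - l) \<le> \<epsilon>" if "n \<ge> N" "finite F" for n F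
    proof (rule LIMSEQ_le_const2)
      show "(\<lambda>m. partial_norm F (u n - u m)) \<longlonglongrightarrow> partial_norm F (u n - l)"
        by (rule tendsto_partial_norm) (auto intro!: tendsto_intros l)
      have "partial_norm F (u n - u m) \<le> \<epsilon>" if "m \<ge> N" for m
        using partial_norm_le_W22_norm[OF W22_diff[OF u u] \<open>finite F\<close>, of n m] N[OF \<open>n \<ge> N\<close> that]
        by simp
      then show "\<exists>N. \<forall>m\<ge>N. partial_norm F (u n - u m) \<le> \<epsilon>"
        by blast
    qed
    then show ?thesis
      using W22_norm_leI by blast
  qed
  obtain n where "u n - l \<in> W22 E \<mu> \<omega>"
    using approx[of 1] by auto
  then have "l \<in> W22 E \<mu> \<omega>"
    using W22_diff[OF u[of n], of "u n - l"] by simp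
  moreover have "\<exists>N. \<forall>n\<ge>N. W22_norm E \<mu> \<omega> (u n - l) < \<epsilon>" if "\<epsilon> > 0" for \<epsilon>
    using approx[of "\<epsilon> / 2"] that by fastforce
  ultimately show "\<exists>l. limitin W22.mtopology u l sequentially"
    using u by (auto simp: W22.limit_metric_sequentially)
qed

section \<open>Energy estimate: the full norm is controlled by the weighted square sum\<close>

lemma energy_le:
  assumes A: "finite A" and C: "\<And>x. (\<Sum>y\<in>E `` {x}. \<omega> x y) \<le> C"
  shows "(\<Sum>x\<in>A. \<Sum>y\<in>E `` {x}. \<omega> x y * (w y - w x)\<^sup>2) \<le> 4 * C * (\<Sum>x\<in>A \<union> E `` A. (w x)\<^sup>2)"
proof -
  let ?B = "A \<union> E `` A"
  have B: "finite ?B"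
    using A locally_finite by (subst Image_eq_UN) auto
  have C0: "0 \<le> C"
    by (rule order_trans[OF sum_nonneg C]) (rule weight_nonneg)
  \<comment> \<open>This separates the two endpoints of each edge; each endpoint will contribute
    \<open>2 * C\<close> to the constant.\<close>
  have sq: "(a - b)\<^sup>2 \<le> 2 * a\<^sup>2 + 2 * b\<^sup>2" for a b :: real
    using zero_le_power2[of "a + b"] by (simp add: power2_sum power2_diff)
  have nbr: "E `` {x} = {y \<in> ?B. (x, y) \<in> E}" if "x \<in> A" for x
    using that by auto
  have "(\<Sum>x\<in>A. \<Sum>y\<in>E `` {x}. \<omega> x y * (w y - w x)\<^sup>2)
      \<le> (\<Sum>x\<in>A. \<Sum>y\<in>E `` {x}. \<omega> x y * (2 * (w y)\<^sup>2 + 2 * (w x)\<^sup>2))"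
    by (intro sum_mono mult_left_mono sq weight_nonneg)
  also have "\<dots> = 2 * (\<Sum>x\<in>A. \<Sum>y\<in>E `` {x}. \<omega> x y * (w y)\<^sup>2)
      + 2 * (\<Sum>x\<in>A. (\<Sum>y\<in>E `` {x}. \<omega> x y) * (w x)\<^sup>2)"
    by (simp add: sum.distrib sum_distrib_left sum_distrib_right algebra_simps)
  \<comment> \<open>For the far endpoint the edges are counted from \<open>y\<close> instead of
    \<open>x\<close>. Confining \<open>y\<close> to the finite set \<open>?B\<close> permits the
    exchange of sums; then symmetry of edges and weights bounds the total weight of the remaining
    \<open>x\<close> by \<open>C\<close>.\<close>
  also have "(\<Sum>x\<in>A. \<Sum>y\<in>E `` {x}. \<omega> x y * (w y)\<^sup>2)
      = (\<Sum>x\<in>A. \<Sum>y | y \<in> ?B \<and> (x, y) \<in> E. \<omega> x y * (w y)\<^sup>2)"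
    by (intro sum.cong) (use nbr in auto)
  also have "\<dots> = (\<Sum>y\<in>?B. \<Sum>x | x \<in> A \<and> (x, y) \<in> E. \<omega> x y * (w y)\<^sup>2)"
    using A B by (rule sum.swap_restrict)
  also have "\<dots> \<le> (\<Sum>y\<in>?B. C * (w y)\<^sup>2)"
  proof (rule sum_mono)
    fix y
    have "(\<Sum>x | x \<in> A \<and> (x, y) \<in> E. \<omega> x y) = (\<Sum>x | x \<in> A \<and> (x, y) \<in> E. \<omega> y x)"
      by (intro sum.cong) (auto intro: weight_sym)
    also have "\<dots> \<le> (\<Sum>x\<in>E `` {y}. \<omega> y x)"
      by (intro sum_mono2 locally_finite weight_nonneg) (use edges_sym in \<open>auto dest: symD\<close>)
    finally have "(\<Sum>x | x \<in> A \<and> (x, y) \<in> E. \<omega> x y) \<le> C"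
      using C[of y] by linarith
    then show "(\<Sum>x | x \<in> A \<and> (x, y) \<in> E. \<omega> x y * (w y)\<^sup>2) \<le> C * (w y)\<^sup>2"
      by (simp add: mult_right_mono flip: sum_distrib_right)
  qed
  \<comment> \<open>The near endpoint meets the weight bound directly; enlarging \<open>A\<close> to
    \<open>?B\<close> then brings both halves to a common range.\<close>
  also have "(\<Sum>x\<in>A. (\<Sum>y\<in>E `` {x}. \<omega> x y) * (w x)\<^sup>2) \<le> (\<Sum>x\<in>A. C * (w x)\<^sup>2)"
    by (intro sum_mono mult_right_mono C) auto
  also have "\<dots> \<le> (\<Sum>x\<in>?B. C * (w x)\<^sup>2)"
    using B C0 by (intro sum_mono2) auto
  finally show ?thesis
    by (simp flip: sum_distrib_left)
qed

text \<open>Cauchy-Schwarz bounds the Laplacian term by the local energy, of which the gradient term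
  is already a multiple, and \<open>energy_le\<close> bounds the sum of the energies. The right-hand
  side includes the neighbours of \<open>F\<close> because the components look one edge outward. The
  constant serves all \<open>F\<close> and \<open>w\<close>.\<close>

lemma partial_norm_le_L2:
  obtains K where "K > 0"
    and "\<And>F w. finite F \<Longrightarrow> (partial_norm F w)\<^sup>2 \<le> K * (\<Sum>x\<in>F \<union> E `` F. \<mu> x * (w x)\<^sup>2)"
proof -
  obtain m where m: "m > 0" "\<And>x. \<mu> x \<ge> m"
    using measure_bounded_below by blast
  obtain C where C: "\<And>x. (\<Sum>y\<in>E `` {x}. \<omega> x y) \<le> C"
    using weights_bounded less_imp_le by metis
  have C0: "0 \<le> C"
    by (rule order_trans[OF sum_nonneg C]) (rule weight_nonneg)
  \<comment> \<open>\<open>C / m\<close> comes from the Laplacian, \<open>1 / 2\<close> from the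
    gradient, \<open>4 * C\<close> from \<open>energy_le\<close>, and the second division by
    \<open>m\<close> from inserting the measure. The final 1 is the zero-order term; it also keeps
    \<open>K\<close> positive when \<open>C = 0\<close>.\<close>
  define K where "K = (C / m + 1 / 2) * (4 * C / m) + 1"
  have "(partial_norm F w)\<^sup>2 \<le> K * (\<Sum>x\<in>F \<union> E `` F. \<mu> x * (w x)\<^sup>2)" if F: "finite F" for F w
  proof -
    let ?B = "F \<union> E `` F"
    let ?S = "\<lambda>x. \<Sum>y\<in>E `` {x}. \<omega> x y * (w y - w x)\<^sup>2"
    have B: "finite ?B"
      using F locally_finite by (subst Image_eq_UN) auto
    have lap: "\<mu> x * (laplacian E \<mu> \<omega> w x)\<^sup>2 \<le> C / m * ?S x" for x
    proof -
      have S0: "0 \<le> ?S x"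
        by (intro sum_nonneg mult_nonneg_nonneg weight_nonneg) auto
      \<comment> \<open>Each weight is split into two square roots, so that Cauchy-Schwarz yields
        the total weight times the local energy.\<close>
      have "(\<Sum>y\<in>E `` {x}. \<omega> x y * (w y - w x))\<^sup>2
          = (\<Sum>y\<in>E `` {x}. sqrt (\<omega> x y) * (sqrt (\<omega> x y) * (w y - w x)))\<^sup>2"
        by (intro arg_cong[where f = "\<lambda>s. s\<^sup>2"] sum.cong)
          (use weight_nonneg in \<open>auto simp flip: mult.assoc\<close>)
      also have "\<dots> \<le> (\<Sum>y\<in>E `` {x}. (sqrt (\<omega> x y))\<^sup>2) * (\<Sum>y\<in>E `` {x}. (sqrt (\<omega> x y) * (w y - w x))\<^sup>2)"
        by (rule Cauchy_Schwarz_ineq_sum)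
      also have "\<dots> = (\<Sum>y\<in>E `` {x}. \<omega> x y) * ?S x"
        by (intro arg_cong2[where f = "(*)"] sum.cong)
          (use weight_nonneg in \<open>auto simp: power_mult_distrib\<close>)
      also have "\<dots> \<le> C * ?S x"
        using C S0 by (intro mult_right_mono) auto
      finally have "(\<Sum>y\<in>E `` {x}. \<omega> x y * (w y - w x))\<^sup>2 / \<mu> x \<le> C * ?S x / m"
        using m C0 S0 by (intro frac_le) auto
      then show ?thesis
        using measure_pos[of x] by (simp add: laplacian_def power_divide power2_eq_square)
    qed
    have "(partial_norm F w)\<^sup>2 = (\<Sum>x\<in>F. \<mu> x * W22_density E \<mu> \<omega> w x)"
      using F measure_pos W22_density_nonneg by (simp add: partial_norm_eq sum_nonneg less_imp_le)
    also have "\<dots> \<le> (\<Sum>x\<in>F. (C / m + 1 / 2) * ?S x + \<mu> x * (w x)\<^sup>2)"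
    proof (rule sum_mono)
      fix x
      have "\<mu> x * grad_sq E \<mu> \<omega> w x = ?S x / 2"
        using measure_pos[of x] by (simp add: grad_sq_def)
      then show "\<mu> x * W22_density E \<mu> \<omega> w x \<le> (C / m + 1 / 2) * ?S x + \<mu> x * (w x)\<^sup>2"
        using lap[of x] by (simp add: W22_density_def distrib_left distrib_right)
    qed
    also have "\<dots> = (C / m + 1 / 2) * (\<Sum>x\<in>F. ?S x) + (\<Sum>x\<in>F. \<mu> x * (w x)\<^sup>2)"
      by (simp add: sum.distrib sum_distrib_left)
    also have "\<dots> \<le> (C / m + 1 / 2) * (4 * C * (\<Sum>x\<in>?B. \<mu> x * (w x)\<^sup>2 / m))
        + (\<Sum>x\<in>?B. \<mu> x * (w x)\<^sup>2)"
    proof (rule add_mono)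
      have "(\<Sum>x\<in>F. ?S x) \<le> 4 * C * (\<Sum>x\<in>?B. (w x)\<^sup>2)"
        by (rule energy_le[OF F C])
      also have "\<dots> \<le> 4 * C * (\<Sum>x\<in>?B. \<mu> x * (w x)\<^sup>2 / m)"
        using m C0 by (intro mult_left_mono sum_mono)
          (simp_all add: pos_le_divide_eq mult.commute[of _ m] mult_right_mono)
      finally show "(C / m + 1 / 2) * (\<Sum>x\<in>F. ?S x)
          \<le> (C / m + 1 / 2) * (4 * C * (\<Sum>x\<in>?B. \<mu> x * (w x)\<^sup>2 / m))"
        using m C0 by (intro mult_left_mono) auto
      show "(\<Sum>x\<in>F. \<mu> x * (w x)\<^sup>2) \<le> (\<Sum>x\<in>?B. \<mu> x * (w x)\<^sup>2)"
        using B measure_pos by (intro sum_mono2) (auto simp: less_imp_le)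
    qed
    also have "\<dots> = K * (\<Sum>x\<in>?B. \<mu> x * (w x)\<^sup>2)"
      by (simp add: K_def algebra_simps flip: sum_divide_distrib)
    finally show ?thesis .
  qed
  moreover have "K > 0"
    unfolding K_def using C0 m by (simp add: add_nonneg_pos)
  ultimately show ?thesis
    by (rule that[rotated])
qed

section \<open>Inclusion and density of the finitely supported functions\<close>

lemma C_c_subset_W22: "C_c \<subseteq> W22 E \<mu> \<omega>"
proof
  fix u :: "'v \<Rightarrow> real" assume "u \<in> C_c"
  then have supp: "finite {x. u x \<noteq> 0}"
    by (simp add: C_c_def)
  obtain K where K: "K > 0"
    "\<And>F w. finite F \<Longrightarrow> (partial_norm F w)\<^sup>2 \<le> K * (\<Sum>x\<in>F \<union> E `` F. \<mu> x * (w x)\<^sup>2)"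
    using partial_norm_le_L2 by blast
  let ?S = "\<Sum>x | u x \<noteq> 0. \<mu> x * (u x)\<^sup>2"
  \<comment> \<open>Only the support contributes to the square sum, so the bound is uniform in
    \<open>F\<close>.\<close>
  have "partial_norm F u \<le> sqrt (K * ?S)" if F: "finite F" for F
  proof (rule real_le_rsqrt)
    have "finite (F \<union> E `` F)"
      using F locally_finite by (subst Image_eq_UN) auto
    then have "(\<Sum>x\<in>F \<union> E `` F. \<mu> x * (u x)\<^sup>2) = (\<Sum>x\<in>(F \<union> E `` F) \<inter> {x. u x \<noteq> 0}. \<mu> x * (u x)\<^sup>2)"
      by (intro sum.mono_neutral_right) auto
    also have "\<dots> \<le> ?S"
      using supp measure_pos by (intro sum_mono2) (auto simp: less_imp_le)
    finally show "(partial_norm F u)\<^sup>2 \<le> K * ?S"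
      using K(2)[OF F, of u] K(1) by (meson mult_left_mono less_imp_le order_trans)
  qed
  then show "u \<in> W22 E \<mu> \<omega>"
    by (rule W22_norm_leI(1))
qed

lemma W22_imp_L2_summable:
  assumes "u \<in> W22 E \<mu> \<omega>"
  shows "(\<lambda>x. \<mu> x * (u x)\<^sup>2) summable_on UNIV"
proof (rule summable_on_comparison_test)
  show "(\<lambda>x. \<mu> x * W22_density E \<mu> \<omega> u x) summable_on UNIV"
    using assms by (simp add: W22_def integrable_V_def)
  show "\<mu> x * (u x)\<^sup>2 \<le> \<mu> x * W22_density E \<mu> \<omega> u x" for x
    unfolding W22_density_def using measure_pos[of x] grad_sq_nonneg[of u x] by simp
  show "0 \<le> \<mu> x * (u x)\<^sup>2" for x
    using measure_pos[of x] by simp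
qed

lemma C_c_dense_W22:
  assumes u: "u \<in> W22 E \<mu> \<omega>" and "\<epsilon> > 0"
  shows "\<exists>v\<in>C_c. W22_norm E \<mu> \<omega> (u - v) < \<epsilon>"
proof -
  obtain K where K: "K > 0"
    "\<And>F w. finite F \<Longrightarrow> (partial_norm F w)\<^sup>2 \<le> K * (\<Sum>x\<in>F \<union> E `` F. \<mu> x * (w x)\<^sup>2)"
    using partial_norm_le_L2 by blast
  define f where "f = (\<lambda>x. \<mu> x * (u x)\<^sup>2)"
  have f: "f summable_on UNIV"
    unfolding f_def by (rule W22_imp_L2_summable[OF u])
  have f0: "0 \<le> f x" for x
    unfolding f_def using measure_pos[of x] by simp
  \<comment> \<open>Chosen so that a tail of mass at most \<open>\<delta>\<close> has norm at most
    \<open>\<epsilon> / 2\<close>; the halving leaves room for the strict inequality.\<close>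
  define \<delta> where "\<delta> = (\<epsilon> / 2)\<^sup>2 / K"
  have "\<delta> > 0"
    unfolding \<delta>_def using K \<open>\<epsilon> > 0\<close> by simp
  then obtain A where A: "finite A" "dist (sum f A) (infsum f UNIV) \<le> \<delta>"
    using infsum_finite_approximation[OF f] by blast
  \<comment> \<open>A sharp cutoff suffices: its jumps across the boundary of \<open>A\<close> are
    absorbed by the energy estimate, which involves only values of \<open>u\<close> outside
    \<open>A\<close>.\<close>
  define v where "v = (\<lambda>x. if x \<in> A then u x else 0)"
  have "partial_norm F (u - v) \<le> \<epsilon> / 2" if F: "finite F" for F
  proof (rule power2_le_imp_le)
    let ?B = "F \<union> E `` F"
    have B: "finite ?B"
      using F locally_finite by (subst Image_eq_UN) auto
    have "(\<Sum>x\<in>?B. \<mu> x * ((u - v) x)\<^sup>2) = (\<Sum>x\<in>?B - A. \<mu> x * ((u - v) x)\<^sup>2)"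
      using B by (intro sum.mono_neutral_right) (auto simp: v_def)
    also have "\<dots> = sum f (?B - A)"
      by (intro sum.cong) (auto simp: v_def f_def)
    \<comment> \<open>The tail is written as a larger finite sum minus the sum over
      \<open>A\<close>, so it is at most the total minus the sum over \<open>A\<close>, whatever
      \<open>F\<close> is.\<close>
    also have "sum f A + sum f (?B - A) = sum f (A \<union> (?B - A))"
      using A(1) B by (intro sum.union_disjoint[symmetric]) auto
    then have "sum f (?B - A) = sum f (A \<union> (?B - A)) - sum f A"
      by simp
    also have "sum f (A \<union> (?B - A)) \<le> infsum f UNIV"
      using A(1) B f0 by (intro finite_sum_le_infsum f) auto
    also have "infsum f UNIV - sum f A \<le> \<delta>"
      using A(2) by (simp add: dist_real_def)
    finally have "K * (\<Sum>x\<in>?B. \<mu> x * ((u - v) x)\<^sup>2) \<le> K * \<delta>"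
      using K(1) by simp
    also have "\<dots> = (\<epsilon> / 2)\<^sup>2"
      using K(1) by (simp add: \<delta>_def)
    finally show "(partial_norm F (u - v))\<^sup>2 \<le> (\<epsilon> / 2)\<^sup>2"
      using K(2)[OF F, of "u - v"] by linarith
  qed (use \<open>\<epsilon> > 0\<close> in simp)
  then have "W22_norm E \<mu> \<omega> (u - v) \<le> \<epsilon> / 2"
    by (rule W22_norm_leI(2))
  moreover have "v \<in> C_c"
    unfolding C_c_def v_def using A(1) by (auto intro: finite_subset)
  ultimately show ?thesis
    using \<open>\<epsilon> > 0\<close> by (intro bexI[of _ v]) auto
qed

lemma closure_of_C_c: "W22.mtopology closure_of C_c = W22 E \<mu> \<omega>"
  unfolding W22.metric_closure_of using C_c_dense_W22 C_c_subset_W22 by fastforce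

end

theorem proposition2p2:
  fixes E :: "('v \<times> 'v) set"
    and \<mu> :: "'v \<Rightarrow> real"
    and \<omega> :: "'v \<Rightarrow> 'v \<Rightarrow> real"
  assumes "weighted_graph E \<mu> \<omega>"
  shows "is_completion_of (W22 E \<mu> \<omega>) C_c (W22_norm E \<mu> \<omega>)"
proof -
  interpret weighted_graph E \<mu> \<omega>
    by (rule assms)
  show ?thesis
    unfolding is_completion_of_def
    by (intro conjI subspace_W22 norm_on_W22 Metric_space_W22 mcomplete_W22 subspace_C_c
        C_c_subset_W22 closure_of_C_c)
qed

end
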